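(* Let $F:\mathbb{R}^d\to\mathbb{R}$ be continuously differentiable, bounded from below by a constant $\underline M\in\mathbb{R}$, with $\|\nabla F(x)-\nabla F(y)\|\le L\|x-y\|$ for all $x,y\in\mathbb{R}^d$, where $L>0$. Let the random vectors $(\theta_n,w_n,z_n,y_n)_{n\ge1}$ be generated from given initial data $(\theta_1,w_1)$, with $\mathbb{E}[F(w_1)]<+\infty$, by $$z_n=(1-\tilde\gamma_n)\odot\theta_n+\tilde\gamma_n\odot w_n,\quad y_n=(1-\mu_n)\theta_n+\mu_n w_n,\quad w_{n+1}=w_n-\lambda_n\odot g_n,\quad \theta_{n+1}=y_n-\alpha_n\odot g_n\qquad(n\ge1),$$ where $\mu_1=1$ and $\mu_n\in(0,1)$ for $n\ge2$ are real numbers, $\tilde\gamma_n\in\mathbb{R}^d$ are (possibly random) positive vectors forming a bounded sequence with $\tilde\gamma_1=\mathbf 1$, and $(\lambda_n)$, $(\alpha_n)$ are (possibly random) positive stepsize vectors in $\mathbb{R}^d$ which are almost surely bounded (by a deterministic constant). Let $B$ be a constant such that $\frac{\|1-\tilde\gamma_n\|^2}{1-\mu_n}\le B$ almost surely for all $n\ge2$. Write $\delta_n=g_n-\nabla F(z_n)$. Let $(\mathcal{F}_n)_{n\ge1}$ be an increasing sequence of $\sigma$-fields such that, for all $n\ge1$: $w_n,z_n,\lambda_n,\alpha_n$ are $\mathcal{F}_n$-measurable, $\mathbb{E}[g_n\mid\mathcal{F}_n]=\nabla F(z_n)$, and $\mathbb{E}[\|\delta_n\|^2\mid\mathcal{F}_n]\le\sigma^2$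 almost surely, for some $\sigma>0$. Let $\Gamma_1=1$, $\Gamma_n=(1-\mu_n)\Gamma_{n-1}$ for $n\ge2$, and $C_{n,N}=\sum_{j=n}^N\Gamma_j$ for $1\le n\le N$. Assume that $(\Gamma_n)$ is bounded and that $C_{n,N}$ admits a strictly positive upper bound (possibly depending on $N$). Assume there are deterministic $m_n>0$ such that, for all $1\le n\le N$, componentwise and almost surely, $$\lambda_n-L[\lambda_n]^2-\frac{LB}{2}\frac{C_{n,N}}{\mu_n\Gamma_n}[\lambda_n-\alpha_n]^2\ \ge\ m_n ,$$ and let $R_n=R_{n,N}>0$ ($1\le n\le N$; possibly depending on $N$) be deterministic numbers such that almost surely $$\|\lambda_n\|^2+B\frac{C_{n,N}}{\mu_n\Gamma_n}\|\lambda_n-\alpha_n\|^2\le R_{n,N}.$$ Put $\overline M=\mathbb{E}[F(w_1)]-\underline M$. Then: (i) For the final iteration $N$, $$\mathbb{E}\Big[\min_{n=1,\dots,N}\|\nabla F(z_n)\|^2\Big]\le\frac{\overline M+\frac L2\sigma^2\sum_{n=1}^{N}R_{n,N}}{\sum_{n=1}^{N}m_n}.$$ (ii) If for every $N\ge1$ the number $C_{n,N}$ ($1\le n\le N$) admits a strictly positive upper bound (possibly depending on $N$) and, for all $1\le n\le N$, almost surely, $\lambda_n-L[\lambda_n]^2-\frac{LB}{2}\frac{C_{n,N}}{\mu_n\Gamma_n}[\lambda_n-\alpha_n]^2\ge m_n$ componentwise and $\|\lambda_n\|^2+B\frac{C_{n,N}}{\mu_n\Gamma_n}\|\lambda_n-\alpha_n\|^2\le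 R_{n,N}$, with deterministic $m_n>0$ and $R_{n,N}>0$ (with $m_n$ not depending on $N$), and if $\sigma^2\lim_{N\to\infty}\sum_{n=1}^{N}R_{n,N}<+\infty$, then $$\sum_{n=1}^{+\infty}m_n\,\mathbb{E}\big[\|\nabla F(z_n)\|^2\big]\le\overline M+\frac L2\sigma^2\lim_{N\to\infty}\sum_{n=1}^{N}R_{n,N}<+\infty.$$
   Context: All norms are Euclidean norms on $\mathbb{R}^d$. $u\odot v$ is the componentwise (Hadamard) product, $[u]^2=u\odot u$; for a scalar $\rho$ and a vector $u$, expressions such as $\rho-u$ are taken componentwise, and $u\ge\rho$ means that every component of $u$ is $\ge\rho$. A vector is positive if all its components are positive; $\mathbf 1=(1,\dots,1)$. The random vector $g_n$ is a noisy (stochastic) evaluation of the gradient $\nabla F$ at the point $z_n$, and $\delta_n$ is its noise. *)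

theory Defs
  imports "HOL-Probability.Probability"
begin

text \<open>
  On \<^typ>\<open>real ^ 'd\<close> the operations \<open>*\<close>, \<open>^ 2\<close> and \<open>1\<close> of the library act componentwise,
  so they are the Hadamard product, the Hadamard square and the all-ones vector; \<open>norm\<close> is
  the Euclidean norm.
\<close>

text \<open>
  The library provides \<^const>\<open>real_cond_exp\<close> for real-valued functions only; for random
  vectors it is taken in each coordinate.
\<close>
definition vec_cond_exp ::
    "'a measure \<Rightarrow> 'a measure \<Rightarrow> ('a \<Rightarrow> real ^ 'd) \<Rightarrow> 'a \<Rightarrow> real ^ 'd" where
  "vec_cond_exp M G X = (\<lambda>\<omega>. \<chi> i. real_cond_exp M G (\<lambda>\<omega>'. X \<omega>' $ i) \<omega>)"

text \<open>Sequences are indexed from 1; the value at 0 is a dummy that is never used.\<close>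
fun Gam :: "(nat \<Rightarrow> real) \<Rightarrow> nat \<Rightarrow> real" where
  "Gam \<mu> 0 = 1"
| "Gam \<mu> (Suc 0) = 1"
| "Gam \<mu> (Suc (Suc n)) = (1 - \<mu> (Suc (Suc n))) * Gam \<mu> (Suc n)"

definition Csum :: "(nat \<Rightarrow> real) \<Rightarrow> nat \<Rightarrow> nat \<Rightarrow> real" where
  "Csum \<mu> n N = (\<Sum>j=n..N. Gam \<mu> j)"

end

theory Submission
  imports Defs
begin

text \<open>
  Write \<open>s\<^sub>n = gradF (z\<^sub>n)\<close>, \<open>e\<^sub>n = g\<^sub>n - s\<^sub>n\<close> and \<open>c\<^sub>n = C\<^sub>n\<^sub>,\<^sub>N / (\<mu>\<^sub>n \<Gamma>\<^sub>n)\<close>. The sequence \<open>w\<^sub>n\<close> performs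
  preconditioned gradient steps whose gradient is evaluated at \<open>z\<^sub>n\<close> instead of \<open>w\<^sub>n\<close>. The
  descent inequality for a function with Lipschitz gradient therefore bounds
  \<open>F (w\<^sub>n\<^sub>+\<^sub>1) - F (w\<^sub>n)\<close> up to an error proportional to \<open>\<parallel>w\<^sub>n - z\<^sub>n\<parallel>\<^sup>2\<close>
  (\<open>one_step_descent\<close>).

  This error is paid for by the averaging: \<open>z\<^sub>n - w\<^sub>n\<close> is the Hadamard product of \<open>1 - \<gamma>\<^sub>n\<close>
  with \<open>\<theta>\<^sub>n - w\<^sub>n\<close>, and the lag \<open>\<theta>\<^sub>n - w\<^sub>n\<close> obeys a linear recursion with damping factor
  \<open>1 - \<mu>\<^sub>n\<close> and forcing \<open>(\<lambda>\<^sub>n - \<alpha>\<^sub>n) \<odot> g\<^sub>n\<close>. By convexity of the squared norm its square obeys a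
  scalar recursion; solving it and interchanging the order of summation
  bounds the accumulated error by a multiple of \<open>\<Sum> c\<^sub>n \<parallel>(\<lambda>\<^sub>n - \<alpha>\<^sub>n) \<odot> g\<^sub>n\<parallel>\<^sup>2\<close>
  (\<open>sum_damped_recursion_le\<close>). This is where the weights \<open>C\<^sub>n\<^sub>,\<^sub>N\<close> come from.

  Expanding every square along \<open>g\<^sub>n = s\<^sub>n + e\<^sub>n\<close> and telescoping gives, path by path, a bound on
  \<open>\<Sum> m\<^sub>n \<parallel>s\<^sub>n\<parallel>\<^sup>2\<close> by \<open>F (w\<^sub>1) - Mlow\<close>, a multiple of \<open>\<Sum> R\<^sub>n \<parallel>e\<^sub>n\<parallel>\<^sup>2\<close>, and a sum of terms that
  are linear in \<open>e\<^sub>n\<close> (\<open>pathwise_energy_bound\<close>). The coefficients of these linear terms depend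
  only on \<open>w\<^sub>n\<close>, \<open>z\<^sub>n\<close> and the stepsizes, so they are known at time \<open>n\<close> and the linear terms
  have expectation zero (\<open>expectation_inner_cond_exp_residual\<close>), while \<open>\<parallel>e\<^sub>n\<parallel>\<^sup>2\<close> has expectation
  at most \<open>\<sigma>\<^sup>2\<close>. Taking expectations yields one inequality from which both parts follow.

  Splitting off the noise before estimating the cross term
  \<open>(gradF (w\<^sub>n) - s\<^sub>n) \<bullet> (\<lambda>\<^sub>n \<odot> g\<^sub>n)\<close> matters: applying Young's inequality to the whole of it would
  double the constant in front of \<open>\<sigma>\<^sup>2 \<parallel>\<lambda>\<^sub>n\<parallel>\<^sup>2\<close>.

  Expectations may only be taken once everything is integrable, and \<open>\<theta>\<^sub>1\<close> is an arbitrary random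
  vector. Integrability is propagated along the iteration from that of \<open>F (w\<^sub>1)\<close>, since a lower
  bound on \<open>F\<close> makes \<open>\<parallel>gradF\<parallel>\<^sup>2\<close> at most a multiple of \<open>F - Mlow\<close>
  (\<open>iterates_square_integrable\<close>).
\<close>

section \<open>Functions with Lipschitz gradient\<close>

text \<open>
  Along the segment from \<open>u\<close> to \<open>v\<close>, the Lipschitz bound says that \<open>F\<close> minus the claimed
  quadratic upper model has nonpositive derivative.
\<close>

lemma descent_lemma:
  fixes F :: "'v::real_inner \<Rightarrow> real"
  assumes grad: "\<And>x. GDERIV F x :> gradF x"
    and lip: "\<And>x y. norm (gradF x - gradF y) \<le> L * norm (x - y)"
  shows "F v \<le> F u + inner (gradF u) (v - u) + L / 2 * (norm (v - u))\<^sup>2"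
proof -
  define d where "d = v - u"
  define \<phi> where "\<phi> = (\<lambda>t::real. F (u + t *\<^sub>R d) - t * inner (gradF u) d - L / 2 * t\<^sup>2 * (norm d)\<^sup>2)"
  have "\<phi> 1 \<le> \<phi> 0"
  proof (rule DERIV_nonpos_imp_nonincreasing[where f = \<phi>])
    fix t :: real assume t: "0 \<le> t"
    have "FDERIV F (u + t *\<^sub>R d) :> (\<lambda>h. inner h (gradF (u + t *\<^sub>R d)))"
      using grad unfolding gderiv_def by blast
    moreover have "((\<lambda>t. u + t *\<^sub>R d) has_derivative (\<lambda>h. h *\<^sub>R d)) (at t)"
      by (auto intro!: derivative_eq_intros)
    ultimately have "((\<lambda>t. F (u + t *\<^sub>R d)) has_derivative (\<lambda>h. inner (h *\<^sub>R d) (gradF (u + t *\<^sub>R d)))) (at t)"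
      using has_derivative_compose[where f = "\<lambda>t. u + t *\<^sub>R d" and g = F] by blast
    then have "DERIV (\<lambda>t. F (u + t *\<^sub>R d)) t :> inner d (gradF (u + t *\<^sub>R d))"
      by (simp add: has_field_derivative_def mult_commute_abs)
    then have D: "DERIV \<phi> t :> inner d (gradF (u + t *\<^sub>R d)) - inner (gradF u) d - L * t * (norm d)\<^sup>2"
      unfolding \<phi>_def by (auto intro!: derivative_eq_intros)
    have "inner d (gradF (u + t *\<^sub>R d)) - inner (gradF u) d = inner d (gradF (u + t *\<^sub>R d) - gradF u)"
      by (simp add: inner_diff_right inner_commute)
    also have "\<dots> \<le> norm d * norm (gradF (u + t *\<^sub>R d) - gradF u)"
      by (rule norm_cauchy_schwarz)
    also have "\<dots> \<le> norm d * (L * norm (u + t *\<^sub>R d - u))"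
      by (intro mult_left_mono lip) auto
    also have "\<dots> = L * t * (norm d)\<^sup>2"
      using t by (simp add: power2_eq_square)
    finally show "\<exists>y. DERIV \<phi> t :> y \<and> y \<le> 0"
      using D by (intro exI[of _ "inner d (gradF (u + t *\<^sub>R d)) - inner (gradF u) d - L * t * (norm d)\<^sup>2"]) auto
  qed simp
  then show ?thesis
    by (simp add: \<phi>_def d_def)
qed

text \<open>
  A step of length \<open>1 / L\<close> along the negative gradient, the minimiser of the quadratic upper
  model, decreases \<open>F\<close> by at least \<open>\<parallel>gradF x\<parallel>\<^sup>2 / (2 L)\<close> and cannot go below \<open>Mlow\<close>.
\<close>

lemma norm_gradient_le_suboptimality:
  fixes F :: "'v::real_inner \<Rightarrow> real"
  assumes descent: "\<And>u v. F v \<le> F u + inner (gradF u) (v - u) + L / 2 * (norm (v - u))\<^sup>2"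
    and low: "\<And>x. Mlow \<le> F x" and L: "L > 0"
  shows "(norm (gradF x))\<^sup>2 \<le> 2 * L * (F x - Mlow)"
proof -
  have "Mlow \<le> F (x - (1 / L) *\<^sub>R gradF x)" by (rule low)
  also have "\<dots> \<le> F x - (1 / L) * (norm (gradF x))\<^sup>2 + L / 2 * (1 / L)\<^sup>2 * (norm (gradF x))\<^sup>2"
    using descent[of "x - (1 / L) *\<^sub>R gradF x" x] L
    by (simp add: power2_norm_eq_inner[symmetric] power_mult_distrib power_divide)
  finally show ?thesis using L by (simp add: field_simps power2_eq_square)
qed

section \<open>Hadamard products and convexity\<close>

lemma inner_hadamard: "inner u (a * v) = inner (a * u) (v :: real ^ 'd)"
  by (simp add: inner_vec_def algebra_simps)

lemma norm_hadamard_le: "norm (a * v) \<le> norm a * norm (v :: real ^ 'd)"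
proof -
  have "norm (a * v) \<le> norm (norm v *\<^sub>R a)"
  proof (rule norm_le_componentwise_cart)
    show "norm ((a * v) $ i) \<le> norm ((norm v *\<^sub>R a) $ i)" for i
      using mult_right_mono[OF component_le_norm_cart[of v i] abs_ge_zero[of "a $ i"]]
      by (simp add: abs_mult mult.commute)
  qed
  then show ?thesis by (simp add: mult.commute)
qed

lemma norm_hadamard_add_sq:
  fixes a u v :: "real ^ 'd"
  shows "(norm (a * (u + v)))\<^sup>2 = (norm (a * u))\<^sup>2 + (norm (a * v))\<^sup>2 + 2 * inner (a * (a * u)) v"
  using inner_hadamard[of "a * u" a v] inner_commute[of "a * v" "a * u"]
  by (simp add: power2_norm_eq_inner inner_add_left inner_add_right distrib_left)

text \<open>
  Convexity of the squared norm for the combination of \<open>u\<close> and \<open>b / t\<close> with weights \<open>1 - t\<close>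
  and \<open>t\<close>. The exact defect is displayed in the proof.
\<close>

lemma norm_convex_combination_sq_le:
  fixes u b :: "'v::real_inner"
  assumes "0 < t" "t \<le> 1"
  shows "(norm ((1 - t) *\<^sub>R u + b))\<^sup>2 \<le> (1 - t) * (norm u)\<^sup>2 + (norm b)\<^sup>2 / t"
proof -
  have "(1 - t) * (norm u)\<^sup>2 + (norm b)\<^sup>2 / t - (norm ((1 - t) *\<^sub>R u + b))\<^sup>2
      = (1 - t) / t * (norm (t *\<^sub>R u - b))\<^sup>2"
    using assms
    by (simp add: power2_norm_eq_inner inner_simps inner_commute field_simps) 
  also have "\<dots> \<ge> 0" using assms by simp
  finally show ?thesis by simp
qed

section \<open>The damped recursion of the lag\<close>

lemma Gam_step: "1 \<le> n \<Longrightarrow> Gam \<mu> (Suc n) = (1 - \<mu> (Suc n)) * Gam \<mu> n"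
  by (cases n) auto

lemma Gam_pos:
  assumes "\<And>n. 2 \<le> n \<Longrightarrow> \<mu> n < 1"
  shows "0 < Gam \<mu> n"
proof (induction n)
  case (Suc n)
  then show ?case using assms[of "Suc n"] by (cases n) auto
qed simp

text \<open>
  Dividing the recursion by \<open>Gam \<mu> n\<close> turns it into a plain summation of
  \<open>a n / (\<mu> n * Gam \<mu> n)\<close>. Because \<open>\<mu> 1 = 1\<close>, the initial value \<open>q 1\<close> is forgotten after one
  step. Exchanging the order of summation then collects the tail sums of \<open>Gam\<close>, which are \<open>Csum\<close>.
\<close>

lemma sum_damped_recursion_le:
  fixes q a :: "nat \<Rightarrow> real"
  assumes rec: "\<And>n. 1 \<le> n \<Longrightarrow> n \<le> N \<Longrightarrow> q (Suc n) \<le> (1 - \<mu> n) * q n + a n / \<mu> n"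
    and \<mu>1: "\<mu> 1 = 1" and \<mu>: "\<And>n. 2 \<le> n \<Longrightarrow> 0 < \<mu> n \<and> \<mu> n < 1"
    and a: "\<And>n. 0 \<le> a n"
  shows "(\<Sum>n=1..N. (1 - \<mu> n) * q n) \<le> (\<Sum>n=1..N. Csum \<mu> n N / (\<mu> n * Gam \<mu> n) * a n)"
proof -
  define b where "b = (\<lambda>n. a n / (\<mu> n * Gam \<mu> n))"
  have Gp: "0 < Gam \<mu> n" for n using Gam_pos \<mu> by blast
  have \<mu>p: "0 < \<mu> n" if "1 \<le> n" for n
    using that \<mu>1 \<mu>[of n] by (cases "n = 1") auto
  have b: "0 \<le> b n" if "1 \<le> n" for n
    using a Gp \<mu>p[OF that] by (simp add: b_def less_imp_le)
  \<comment> \<open>the solved recursion; at \<open>n = 1\<close> the coefficient \<open>1 - \<mu> 1\<close> removes \<open>q 1\<close>\<close>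
  have q: "q (Suc n) \<le> Gam \<mu> n * (\<Sum>k=1..n. b k)" if "1 \<le> n" "n \<le> N" for n
    using that
  proof (induction n rule: nat_induct_at_least)
    case base
    then show ?case using rec[of 1] \<mu>1 by (simp add: b_def)
  next
    case (Suc n)
    have "q (Suc (Suc n)) \<le> (1 - \<mu> (Suc n)) * q (Suc n) + a (Suc n) / \<mu> (Suc n)"
      using Suc by (intro rec) auto
    also have "\<dots> \<le> (1 - \<mu> (Suc n)) * (Gam \<mu> n * (\<Sum>k=1..n. b k)) + a (Suc n) / \<mu> (Suc n)"
      using Suc \<mu>[of "Suc n"] by (intro add_right_mono mult_left_mono) auto
    also have "a (Suc n) / \<mu> (Suc n) = Gam \<mu> (Suc n) * b (Suc n)"
      using Gp[of "Suc n"] by (simp add: b_def)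
    also have "(1 - \<mu> (Suc n)) * (Gam \<mu> n * (\<Sum>k=1..n. b k)) + Gam \<mu> (Suc n) * b (Suc n)
        = Gam \<mu> (Suc n) * (\<Sum>k=1..Suc n. b k)"
      by (simp add: Gam_step[OF Suc(1)] algebra_simps)
    finally show ?case .
  qed
  \<comment> \<open>The sum on the right could stop at \<open>n - 1\<close>; the extra term \<open>k = n\<close> makes the tails start at \<open>k\<close>, as in \<open>Csum\<close>.\<close>
  have "(1 - \<mu> n) * q n \<le> Gam \<mu> n * (\<Sum>k=1..n. b k)" if n: "n \<in> {1..N}" for n
  proof (cases "n = 1")
    case True
    then show ?thesis using \<mu>1 b[of 1] by simp
  next
    case False
    then obtain k where k: "n = Suc k" "1 \<le> k" using n by (cases n) auto
    have "(1 - \<mu> n) * q n \<le> (1 - \<mu> n) * (Gam \<mu> k * (\<Sum>j=1..k. b j))"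
      using q[of k] k n \<mu>[of n] by (intro mult_left_mono) auto
    also have "\<dots> = Gam \<mu> n * (\<Sum>j=1..k. b j)"
      using Gam_step[OF k(2), of \<mu>] k by simp
    also have "\<dots> \<le> Gam \<mu> n * (\<Sum>j=1..n. b j)"
      using Gp[of n] b[of n] n k by (intro mult_left_mono) auto
    finally show ?thesis .
  qed
  then have "(\<Sum>n=1..N. (1 - \<mu> n) * q n) \<le> (\<Sum>n=1..N. \<Sum>k=1..n. Gam \<mu> n * b k)"
    by (intro sum_mono) (simp add: sum_distrib_left)
  also have "\<dots> = (\<Sum>n\<in>{1..N}. \<Sum>k | k \<in> {1..N} \<and> k \<le> n. Gam \<mu> n * b k)"
    by (intro sum.cong refl) auto
  also have "\<dots> = (\<Sum>k\<in>{1..N}. \<Sum>n | n \<in> {1..N} \<and> k \<le> n. Gam \<mu> n * b k)"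
    by (rule sum.swap_restrict) auto
  also have "\<dots> = (\<Sum>k=1..N. Csum \<mu> k N * b k)"
  proof (rule sum.cong[OF refl])
    fix k assume "k \<in> {1..N}"
    then have "{n. n \<in> {1..N} \<and> k \<le> n} = {k..N}" by auto
    then show "(\<Sum>n | n \<in> {1..N} \<and> k \<le> n. Gam \<mu> n * b k) = Csum \<mu> k N * b k"
      by (simp add: Csum_def sum_distrib_right)
  qed
  also have "\<dots> = (\<Sum>n=1..N. Csum \<mu> n N / (\<mu> n * Gam \<mu> n) * a n)"
    by (simp add: b_def)
  finally show ?thesis .
qed

section \<open>The energy inequality along a single path\<close>

text \<open>
  Here \<open>l\<close> is the stepsize vector and \<open>e\<close> the noise in the gradient at \<open>z\<close>. The mismatch
  \<open>gradF w - gradF z\<close> is estimated by Young's inequality only against the noise-free part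
  \<open>l * gradF z\<close> of the step; its product with \<open>l * e\<close> is kept in the last term, which is linear in
  \<open>e\<close> and will vanish in expectation.
\<close>

lemma one_step_descent:
  fixes F :: "real ^ 'd \<Rightarrow> real"
  assumes descent: "\<And>u v. F v \<le> F u + inner (gradF u) (v - u) + L / 2 * (norm (v - u))\<^sup>2"
    and lip: "\<And>x y. norm (gradF x - gradF y) \<le> L * norm (x - y)" and L: "L > 0"
  shows "F (w - l * (gradF z + e)) \<le> F w - inner (gradF z) (l * gradF z)
     + L * (norm (l * gradF z))\<^sup>2 + L / 2 * (norm (w - z))\<^sup>2 + L / 2 * (norm (l * e))\<^sup>2
     + inner (L *\<^sub>R (l * (l * gradF z)) - l * gradF w) e"
proof -
  define s where "s = gradF z"
  have cross: "- inner (gradF w - s) (l * s) \<le> L / 2 * (norm (w - z))\<^sup>2 + L / 2 * (norm (l * s))\<^sup>2"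
  proof -
    have "- inner (gradF w - s) (l * s) \<le> norm (gradF w - s) * norm (l * s)"
      using Cauchy_Schwarz_ineq2[of "gradF w - s" "l * s"] by linarith
    also have "\<dots> \<le> L * norm (w - z) * norm (l * s)"
      unfolding s_def by (intro mult_right_mono lip) auto
    also have "\<dots> \<le> L / 2 * (norm (w - z))\<^sup>2 + L / 2 * (norm (l * s))\<^sup>2"
    proof -
      have "0 \<le> L / 2 * (norm (w - z) - norm (l * s))\<^sup>2" using L by simp
      then show ?thesis by (simp add: power2_diff algebra_simps)
    qed
    finally show ?thesis .
  qed
  have "F (w - l * (s + e)) \<le> F w - inner (gradF w) (l * s + l * e) + L / 2 * (norm (l * (s + e)))\<^sup>2"
  proof -
    have step: "w - l * (s + e) - w = - (l * (s + e))" by simp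
    show ?thesis
      using descent[of "w - l * (s + e)" w]
      unfolding step inner_minus_right norm_minus_cancel distrib_left[of l s e, symmetric] by linarith
  qed
  also have "(norm (l * (s + e)))\<^sup>2 = (norm (l * s))\<^sup>2 + (norm (l * e))\<^sup>2 + 2 * inner (l * (l * s)) e"
    by (rule norm_hadamard_add_sq)
  also have "inner (gradF w) (l * s + l * e) = inner s (l * s) + inner (gradF w - s) (l * s) + inner (l * gradF w) e"
    by (simp add: inner_add_right inner_diff_left inner_hadamard[of "gradF w" l e])
  finally show ?thesis
    using cross unfolding s_def[symmetric] by (simp add: inner_simps algebra_simps)
qed


text \<open>
  The vector that multiplies the noise \<open>e\<close> linearly in the energy inequality. Its three parts come
  from expanding \<open>\<parallel>l * (gradF z + e)\<parallel>\<^sup>2\<close>, from expanding the forcing of the lag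
  \<open>\<parallel>(l - a) * (gradF z + e)\<parallel>\<^sup>2\<close> (with \<open>\<kappa>\<close> the weight that the recursion of the lag gives to it),
  and from the first-order term of the descent inequality. It involves no quantity
  from after the gradient is sampled.
\<close>

definition noise_coeff ::
    "(real ^ 'd \<Rightarrow> real ^ 'd) \<Rightarrow> real \<Rightarrow> real \<Rightarrow> real ^ 'd \<Rightarrow> real ^ 'd \<Rightarrow> real ^ 'd \<Rightarrow> real ^ 'd \<Rightarrow> real ^ 'd" where
  "noise_coeff gradF L \<kappa> l a w z =
     L *\<^sub>R (l * (l * gradF z)) + (L * \<kappa>) *\<^sub>R ((l - a) * ((l - a) * gradF z)) - l * gradF w"

text \<open>
  The three terms on the right are diagonal quadratic forms in \<open>s\<close>, so the componentwise
  hypothesis compares the coefficients of \<open>(s $ i)\<^sup>2\<close>.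
\<close>

lemma gradient_weight_le:
  fixes s l a :: "real ^ 'd"
  assumes "\<And>i. m \<le> (l - L *\<^sub>R l\<^sup>2 - k *\<^sub>R (l - a)\<^sup>2) $ i"
  shows "m * (norm s)\<^sup>2 \<le> inner s (l * s) - L * (norm (l * s))\<^sup>2 - k * (norm ((l - a) * s))\<^sup>2"
proof -
  have "m * (norm s)\<^sup>2 = (\<Sum>i\<in>UNIV. m * (s $ i * s $ i))"
    by (simp add: power2_norm_eq_inner inner_vec_def sum_distrib_left)
  also have "\<dots> \<le> (\<Sum>i\<in>UNIV. (l - L *\<^sub>R l\<^sup>2 - k *\<^sub>R (l - a)\<^sup>2) $ i * (s $ i * s $ i))"
    by (intro sum_mono mult_right_mono assms) auto
  also have "\<dots> = inner s (l * s) - L * (norm (l * s))\<^sup>2 - k * (norm ((l - a) * s))\<^sup>2"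
    unfolding power2_norm_eq_inner inner_vec_def sum_distrib_left sum_subtractf[symmetric]
    by (intro sum.cong refl) (simp add: power2_eq_square algebra_simps)
  finally show ?thesis .
qed

text \<open>
  The energy inequality for one realisation. In the proof, \<open>q n\<close> is the squared lag between
  \<open>\<theta> n\<close> and \<open>w n\<close>, and \<open>p n\<close> is its forcing. The bound on \<open>\<parallel>1 - \<gamma> n\<parallel>\<^sup>2\<close> converts the factor
  left over from \<open>w n - z n\<close> into \<open>B * (1 - \<mu> n)\<close>, which is the damping factor that
  \<open>sum_damped_recursion_le\<close> expects.
\<close>

lemma pathwise_energy_bound:
  fixes F :: "real ^ 'd \<Rightarrow> real" and w \<theta> z g \<gamma> l a :: "nat \<Rightarrow> real ^ 'd"
    and \<mu> :: "nat \<Rightarrow> real" and N :: nat and B :: real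
  defines "c \<equiv> \<lambda>n. Csum \<mu> n N / (\<mu> n * Gam \<mu> n)"
  assumes descent: "\<And>u v. F v \<le> F u + inner (gradF u) (v - u) + L / 2 * (norm (v - u))\<^sup>2"
    and lip: "\<And>x y. norm (gradF x - gradF y) \<le> L * norm (x - y)" and L: "L > 0"
    and low: "\<And>x. Mlow \<le> F x"
    and B: "0 \<le> B"
    and \<mu>1: "\<mu> 1 = 1" and \<mu>: "\<And>n. 2 \<le> n \<Longrightarrow> 0 < \<mu> n \<and> \<mu> n < 1"
    and z: "\<And>n. n \<in> {1..N} \<Longrightarrow> z n = (1 - \<gamma> n) * \<theta> n + \<gamma> n * w n"
    and w: "\<And>n. n \<in> {1..N} \<Longrightarrow> w (Suc n) = w n - l n * g n"
    and \<theta>: "\<And>n. n \<in> {1..N} \<Longrightarrow> \<theta> (Suc n) = (1 - \<mu> n) *\<^sub>R \<theta> n + \<mu> n *\<^sub>R w n - a n * g n"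
    and \<gamma>1: "\<gamma> 1 = 1"
    and \<gamma>: "\<And>n. n \<in> {2..N} \<Longrightarrow> (norm (1 - \<gamma> n))\<^sup>2 / (1 - \<mu> n) \<le> B"
    and m: "\<And>n i. n \<in> {1..N} \<Longrightarrow>
              m n \<le> (l n - L *\<^sub>R (l n)\<^sup>2 - (L * B / 2 * c n) *\<^sub>R (l n - a n)\<^sup>2) $ i"
    and R: "\<And>n. n \<in> {1..N} \<Longrightarrow> (norm (l n))\<^sup>2 + B * c n * (norm (l n - a n))\<^sup>2 \<le> R n"
  shows "(\<Sum>n=1..N. m n * (norm (gradF (z n)))\<^sup>2)
    \<le> F (w 1) - Mlow + (\<Sum>n=1..N. L / 2 * R n * (norm (g n - gradF (z n)))\<^sup>2)
      + (\<Sum>n=1..N. inner (noise_coeff gradF L (B * c n) (l n) (a n) (w n) (z n)) (g n - gradF (z n)))"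
proof -
  define s where "s = (\<lambda>n. gradF (z n))"
  define e where "e = (\<lambda>n. g n - s n)"
  define h where "h = (\<lambda>n. noise_coeff gradF L (B * c n) (l n) (a n) (w n) (z n))"
  define q where "q = (\<lambda>n. (norm (\<theta> n - w n))\<^sup>2)"
  define p where "p = (\<lambda>n. (norm ((l n - a n) * g n))\<^sup>2)"
  have g: "g n = s n + e n" for n by (simp add: e_def)
  have c: "0 \<le> c n" if "n \<in> {1..N}" for n
  proof -
    have "0 < \<mu> n" using that \<mu>1 \<mu>[of n] by (cases "n = 1") auto
    moreover have "0 < Gam \<mu> k" for k using Gam_pos \<mu> by blast
    ultimately show ?thesis
      unfolding c_def Csum_def by (intro divide_nonneg_nonneg sum_nonneg mult_nonneg_nonneg less_imp_le) auto
  qed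
  have q: "(\<Sum>n=1..N. (1 - \<mu> n) * q n) \<le> (\<Sum>n=1..N. c n * p n)"
    unfolding c_def
  proof (rule sum_damped_recursion_le)
    fix n assume n: "1 \<le> n" "n \<le> N"
    have "\<theta> (Suc n) - w (Suc n) = (1 - \<mu> n) *\<^sub>R (\<theta> n - w n) + (l n - a n) * g n"
      using n by (simp add: \<theta> w vec_eq_iff algebra_simps)
    moreover have "0 < \<mu> n" "\<mu> n \<le> 1"
      using n \<mu>1 \<mu>[of n] by (cases "n = 1"; force)+
    ultimately show "q (Suc n) \<le> (1 - \<mu> n) * q n + p n / \<mu> n"
      unfolding q_def p_def using norm_convex_combination_sq_le by metis
  qed (use \<mu>1 \<mu> in \<open>auto simp: p_def\<close>)
  have wz: "(norm (w n - z n))\<^sup>2 \<le> B * ((1 - \<mu> n) * q n)" if n: "n \<in> {1..N}" for n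
  proof (cases "n = 1")
    case True
    then show ?thesis using z[OF n] \<gamma>1 \<mu>1 by simp
  next
    case False
    then have n2: "n \<in> {2..N}" using n by auto
    have "w n - z n = (1 - \<gamma> n) * (w n - \<theta> n)"
      using z[OF n] by (simp add: vec_eq_iff algebra_simps)
    then have "(norm (w n - z n))\<^sup>2 \<le> (norm (1 - \<gamma> n))\<^sup>2 * q n"
      unfolding q_def power_mult_distrib[symmetric]
      using norm_hadamard_le[of "1 - \<gamma> n" "w n - \<theta> n"] by (simp add: power_mono norm_minus_commute)
    also have "\<dots> \<le> B * (1 - \<mu> n) * q n"
      using \<gamma>[OF n2] \<mu>[of n] n2 by (intro mult_right_mono) (auto simp: q_def divide_le_eq)
    finally show ?thesis by (simp add: algebra_simps)
  qed
  \<comment> \<open>The forcing \<open>p n\<close> is added to and subtracted from the one-step estimate: the added copy completes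
    the coefficients in \<open>m\<close> and \<open>R\<close>, the subtracted one absorbs the lag after summation.\<close>
  have step: "F (w (Suc n)) - F (w n) + m n * (norm (s n))\<^sup>2
      \<le> L / 2 * R n * (norm (e n))\<^sup>2 + inner (h n) (e n)
        + L * B / 2 * ((1 - \<mu> n) * q n) - L * B / 2 * (c n * p n)"
    if n: "n \<in> {1..N}" for n
  proof -
    have 1: "F (w (Suc n)) \<le> F (w n) - inner (s n) (l n * s n) + L * (norm (l n * s n))\<^sup>2
        + L / 2 * (norm (w n - z n))\<^sup>2 + L / 2 * (norm (l n * e n))\<^sup>2
        + inner (L *\<^sub>R (l n * (l n * s n)) - l n * gradF (w n)) (e n)"
      using one_step_descent[OF descent lip L, of "w n" "l n" "z n" "e n"] w[OF n]
      unfolding g s_def by simp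
    have 2: "m n * (norm (s n))\<^sup>2 \<le> inner (s n) (l n * s n) - L * (norm (l n * s n))\<^sup>2
        - L * B / 2 * c n * (norm ((l n - a n) * s n))\<^sup>2"
      by (rule gradient_weight_le) (use m[OF n] in simp)
    have 3: "p n = (norm ((l n - a n) * s n))\<^sup>2 + (norm ((l n - a n) * e n))\<^sup>2
        + 2 * inner ((l n - a n) * ((l n - a n) * s n)) (e n)"
      unfolding p_def g by (rule norm_hadamard_add_sq)
    have 4: "L / 2 * (norm (w n - z n))\<^sup>2 \<le> L * B / 2 * ((1 - \<mu> n) * q n)"
      using mult_left_mono[OF wz[OF n], of "L / 2"] L by simp
    have "(norm (l n * e n))\<^sup>2 + B * c n * (norm ((l n - a n) * e n))\<^sup>2
        \<le> (norm (l n) * norm (e n))\<^sup>2 + B * c n * (norm (l n - a n) * norm (e n))\<^sup>2"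
      using B c[OF n] by (intro add_mono mult_left_mono power_mono norm_hadamard_le) auto
    also have "\<dots> = ((norm (l n))\<^sup>2 + B * c n * (norm (l n - a n))\<^sup>2) * (norm (e n))\<^sup>2"
      by (simp add: power_mult_distrib algebra_simps)
    also have "\<dots> \<le> R n * (norm (e n))\<^sup>2"
      by (intro mult_right_mono R[OF n]) auto
    finally have 5: "L / 2 * ((norm (l n * e n))\<^sup>2 + B * c n * (norm ((l n - a n) * e n))\<^sup>2)
        \<le> L / 2 * (R n * (norm (e n))\<^sup>2)"
      using L by (intro mult_left_mono) auto
    have 6: "inner (h n) (e n) = inner (L *\<^sub>R (l n * (l n * s n)) - l n * gradF (w n)) (e n)
        + L * (B * c n) * inner ((l n - a n) * ((l n - a n) * s n)) (e n)"
      by (simp add: h_def noise_coeff_def s_def inner_simps)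
    show ?thesis
      using 1 2 4 5 unfolding 3 6 by (simp add: algebra_simps)
  qed
  have "(\<Sum>n=1..N. F (w (Suc n)) - F (w n)) + (\<Sum>n=1..N. m n * (norm (s n))\<^sup>2)
      \<le> (\<Sum>n=1..N. L / 2 * R n * (norm (e n))\<^sup>2) + (\<Sum>n=1..N. inner (h n) (e n))
        + L * B / 2 * (\<Sum>n=1..N. (1 - \<mu> n) * q n) - L * B / 2 * (\<Sum>n=1..N. c n * p n)"
    unfolding sum_distrib_left sum.distrib[symmetric] sum_subtractf[symmetric]
    by (intro sum_mono step)
  moreover have "L * B / 2 * (\<Sum>n=1..N. (1 - \<mu> n) * q n) \<le> L * B / 2 * (\<Sum>n=1..N. c n * p n)"
    using L B by (intro mult_left_mono q) auto
  moreover have "(\<Sum>n=1..N. F (w (Suc n)) - F (w n)) = F (w (Suc N)) - F (w 1)"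
    by (rule sum_Suc_diff) simp
  ultimately show ?thesis
    using low[of "w (Suc N)"] unfolding s_def e_def h_def by linarith
qed

section \<open>Square-integrable random vectors\<close>

lemma borel_measurable_component:
  fixes X :: "'a \<Rightarrow> real ^ 'd"
  assumes "X \<in> borel_measurable N"
  shows "(\<lambda>\<omega>. X \<omega> $ i) \<in> borel_measurable N"
  by (rule borel_measurable_continuous_on[OF _ assms]) (intro continuous_intros)

lemma borel_measurable_hadamard:
  fixes X Y :: "'a \<Rightarrow> real ^ 'd"
  assumes "X \<in> borel_measurable N" "Y \<in> borel_measurable N"
  shows "(\<lambda>\<omega>. X \<omega> * Y \<omega>) \<in> borel_measurable N"
proof -
  have "(\<lambda>\<omega>. (X \<omega> * Y \<omega>) \<bullet> axis i 1) \<in> borel_measurable N" for i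
    using assms[THEN borel_measurable_component, of i]
    by (simp add: inner_axis borel_measurable_times)
  then show ?thesis
    by (subst borel_measurable_euclidean_space) (auto simp: Basis_vec_def)
qed

definition square_integrable ::
    "'a measure \<Rightarrow> ('a \<Rightarrow> 'b::euclidean_space) \<Rightarrow> bool" where
  "square_integrable M X \<longleftrightarrow>
     X \<in> borel_measurable M \<and> integrable M (\<lambda>\<omega>. (norm (X \<omega>))\<^sup>2)"

lemma square_integrable_measurable: "square_integrable M X \<Longrightarrow> X \<in> borel_measurable M"
  by (simp add: square_integrable_def)

lemma square_integrable_bound:
  assumes X: "X \<in> borel_measurable M" and f: "integrable M f"
    and le: "AE \<omega> in M. (norm (X \<omega>))\<^sup>2 \<le> f \<omega>"
  shows "square_integrable M X"
proof -
  have "integrable M (\<lambda>\<omega>. (norm (X \<omega>))\<^sup>2)"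
    by (rule Bochner_Integration.integrable_bound[OF f])
      (use X le in \<open>auto intro!: borel_measurable_power elim!: eventually_mono\<close>)
  then show ?thesis using X by (simp add: square_integrable_def)
qed

lemma square_integrable_scaleR:
  assumes "square_integrable M X"
  shows "square_integrable M (\<lambda>\<omega>. k *\<^sub>R X \<omega>)"
  using assms by (auto simp: square_integrable_def power_mult_distrib)

lemma square_integrable_add:
  assumes X: "square_integrable M X" and Y: "square_integrable M Y"
  shows "square_integrable M (\<lambda>\<omega>. X \<omega> + Y \<omega>)"
proof (rule square_integrable_bound)
  show "(\<lambda>\<omega>. X \<omega> + Y \<omega>) \<in> borel_measurable M"
    using X Y by (intro borel_measurable_add square_integrable_measurable)
  show "integrable M (\<lambda>\<omega>. 2 * (norm (X \<omega>))\<^sup>2 + 2 * (norm (Y \<omega>))\<^sup>2)"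
    using X Y by (simp add: square_integrable_def)
  have "(norm (x + y))\<^sup>2 \<le> 2 * (norm x)\<^sup>2 + 2 * (norm y)\<^sup>2" for x y :: 'b
    using power_mono[OF norm_triangle_ineq[of x y] norm_ge_zero, of 2]
      sum_squares_bound[of "norm x" "norm y"] unfolding power2_sum by linarith
  then show "AE \<omega> in M. (norm (X \<omega> + Y \<omega>))\<^sup>2 \<le> 2 * (norm (X \<omega>))\<^sup>2 + 2 * (norm (Y \<omega>))\<^sup>2"
    by simp
qed

lemma square_integrable_diff:
  assumes "square_integrable M X" "square_integrable M Y"
  shows "square_integrable M (\<lambda>\<omega>. X \<omega> - Y \<omega>)"
  using square_integrable_add[OF assms(1) square_integrable_scaleR[OF assms(2), of "-1"]] by simp

lemma square_integrable_hadamard_bounded: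
  fixes l X :: "'a \<Rightarrow> real ^ 'd"
  assumes l: "l \<in> borel_measurable M" and K: "AE \<omega> in M. norm (l \<omega>) \<le> K"
    and X: "square_integrable M X"
  shows "square_integrable M (\<lambda>\<omega>. l \<omega> * X \<omega>)"
proof (rule square_integrable_bound)
  show "(\<lambda>\<omega>. l \<omega> * X \<omega>) \<in> borel_measurable M"
    by (intro borel_measurable_hadamard l square_integrable_measurable X)
  show "integrable M (\<lambda>\<omega>. K\<^sup>2 * (norm (X \<omega>))\<^sup>2)"
    using X by (simp add: square_integrable_def)
  show "AE \<omega> in M. (norm (l \<omega> * X \<omega>))\<^sup>2 \<le> K\<^sup>2 * (norm (X \<omega>))\<^sup>2"
    using K
  proof eventually_elim
    case (elim \<omega>)
    have "norm (l \<omega> * X \<omega>) \<le> K * norm (X \<omega>)"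
      using norm_hadamard_le[of "l \<omega>" "X \<omega>"] mult_right_mono[OF elim, of "norm (X \<omega>)"] by simp
    then show ?case
      unfolding power_mult_distrib[symmetric] by (intro power_mono) auto
  qed
qed

lemma integrable_inner_square_integrable:
  assumes X: "square_integrable M X" and Y: "square_integrable M Y"
  shows "integrable M (\<lambda>\<omega>. X \<omega> \<bullet> Y \<omega>)"
proof (rule Bochner_Integration.integrable_bound)
  show "integrable M (\<lambda>\<omega>. (norm (X \<omega>))\<^sup>2 + (norm (Y \<omega>))\<^sup>2)"
    using X Y by (simp add: square_integrable_def)
  show "(\<lambda>\<omega>. X \<omega> \<bullet> Y \<omega>) \<in> borel_measurable M"
    using X Y by (intro borel_measurable_inner square_integrable_measurable)
  have "\<bar>x \<bullet> y\<bar> \<le> \<bar>(norm x)\<^sup>2 + (norm y)\<^sup>2\<bar>" for x y :: 'b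
    using Cauchy_Schwarz_ineq2[of x y] sum_squares_bound[of "norm x" "norm y"]
      mult_nonneg_nonneg[of "norm x" "norm y"]
    by (simp add: abs_of_nonneg)
  then show "AE \<omega> in M. norm (X \<omega> \<bullet> Y \<omega>) \<le> norm ((norm (X \<omega>))\<^sup>2 + (norm (Y \<omega>))\<^sup>2)"
    by simp
qed

lemma square_integrable_component:
  fixes X :: "'a \<Rightarrow> real ^ 'd"
  assumes X: "square_integrable M X"
  shows "square_integrable M (\<lambda>\<omega>. X \<omega> $ i)"
proof (rule square_integrable_bound)
  show "(\<lambda>\<omega>. X \<omega> $ i) \<in> borel_measurable M"
    by (intro borel_measurable_component square_integrable_measurable X)
  show "integrable M (\<lambda>\<omega>. (norm (X \<omega>))\<^sup>2)"
    using X by (simp add: square_integrable_def)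
  have "(norm (x $ i))\<^sup>2 \<le> (norm x)\<^sup>2" for x :: "real ^ 'd"
    using component_le_norm_cart[of x i] by (intro power_mono) auto
  then show "AE \<omega> in M. (norm (X \<omega> $ i))\<^sup>2 \<le> (norm (X \<omega>))\<^sup>2" by simp
qed

section \<open>Conditional expectation and the noise\<close>

text \<open>
  The residual \<open>g - s\<close> of a conditional expectation is orthogonal to everything known before
  sampling. Since \<open>vec_cond_exp\<close> acts in each coordinate, this is the defining property of
  \<open>real_cond_exp\<close> summed over the coordinates; square integrability makes each product integrable.
\<close>

lemma expectation_inner_cond_exp_residual:
  fixes h g s :: "'a \<Rightarrow> real ^ 'd"
  assumes M: "prob_space M" and G: "subalgebra M G"
    and hG: "h \<in> borel_measurable G" and h: "square_integrable M h"
    and g: "square_integrable M g" and s: "square_integrable M s"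
    and ce: "AE \<omega> in M. vec_cond_exp M G g \<omega> = s \<omega>"
  shows "(\<integral>\<omega>. h \<omega> \<bullet> (g \<omega> - s \<omega>) \<partial>M) = 0"
proof -
  interpret prob_space M by (rule M)
  interpret finite_measure_subalgebra M G by unfold_locales (rule G)
  note comp = square_integrable_component[OF h] square_integrable_component[OF g]
    square_integrable_component[OF s]
  have int: "integrable M (\<lambda>\<omega>. h \<omega> $ i * g \<omega> $ i)" "integrable M (\<lambda>\<omega>. h \<omega> $ i * s \<omega> $ i)" for i
    using integrable_inner_square_integrable[OF comp(1) comp(2), of i i]
      integrable_inner_square_integrable[OF comp(1) comp(3), of i i] by simp_all
  have eq: "(\<integral>\<omega>. h \<omega> $ i * g \<omega> $ i \<partial>M) = (\<integral>\<omega>. h \<omega> $ i * s \<omega> $ i \<partial>M)" for i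
  proof -
    have hi: "(\<lambda>\<omega>. h \<omega> $ i) \<in> borel_measurable G" "(\<lambda>\<omega>. g \<omega> $ i) \<in> borel_measurable M"
      using hG g by (auto intro: borel_measurable_component square_integrable_measurable)
    note rc = real_cond_exp_intg[OF int(1)[of i] hi]
    have "(\<integral>\<omega>. h \<omega> $ i * g \<omega> $ i \<partial>M) = (\<integral>\<omega>. h \<omega> $ i * real_cond_exp M G (\<lambda>\<omega>'. g \<omega>' $ i) \<omega> \<partial>M)"
      by (rule rc(2)[symmetric])
    also have "\<dots> = (\<integral>\<omega>. h \<omega> $ i * s \<omega> $ i \<partial>M)"
    proof (rule integral_cong_AE)
      show "AE \<omega> in M. h \<omega> $ i * real_cond_exp M G (\<lambda>\<omega>'. g \<omega>' $ i) \<omega> = h \<omega> $ i * s \<omega> $ i"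
        using ce by eventually_elim (auto simp: vec_cond_exp_def vec_eq_iff)
    qed (use rc(1) int(2) in auto)
    finally show ?thesis .
  qed
  have "(\<integral>\<omega>. h \<omega> \<bullet> (g \<omega> - s \<omega>) \<partial>M) = (\<integral>\<omega>. (\<Sum>i\<in>UNIV. h \<omega> $ i * g \<omega> $ i - h \<omega> $ i * s \<omega> $ i) \<partial>M)"
    by (simp add: inner_vec_def right_diff_distrib)
  also have "\<dots> = 0"
    using int eq by simp
  finally show ?thesis .
qed

lemma square_integrable_of_cond_second_moment:
  fixes e :: "'a \<Rightarrow> real ^ 'd"
  assumes M: "prob_space M" and G: "subalgebra M G" and e: "e \<in> borel_measurable M"
    and le: "AE \<omega> in M. nn_cond_exp M G (\<lambda>\<omega>'. ennreal ((norm (e \<omega>'))\<^sup>2)) \<omega> \<le> ennreal (\<sigma>\<^sup>2)"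
  shows "square_integrable M e" "(\<integral>\<omega>. (norm (e \<omega>))\<^sup>2 \<partial>M) \<le> \<sigma>\<^sup>2"
proof -
  interpret prob_space M by (rule M)
  interpret finite_measure_subalgebra M G by unfold_locales (rule G)
  have m: "(\<lambda>\<omega>. ennreal ((norm (e \<omega>))\<^sup>2)) \<in> borel_measurable M" using e by simp
  have "(\<integral>\<^sup>+\<omega>. ennreal ((norm (e \<omega>))\<^sup>2) \<partial>M)
      = (\<integral>\<^sup>+\<omega>. nn_cond_exp M G (\<lambda>\<omega>'. ennreal ((norm (e \<omega>'))\<^sup>2)) \<omega> \<partial>M)"
    using nn_cond_exp_intg[OF _ m, of "\<lambda>_. 1"] by simp
  also have "\<dots> \<le> (\<integral>\<^sup>+\<omega>. ennreal (\<sigma>\<^sup>2) \<partial>M)" by (rule nn_integral_mono_AE[OF le])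
  also have "\<dots> = ennreal (\<sigma>\<^sup>2)" by (simp add: emeasure_space_1)
  finally have nn: "(\<integral>\<^sup>+\<omega>. ennreal ((norm (e \<omega>))\<^sup>2) \<partial>M) \<le> ennreal (\<sigma>\<^sup>2)" .
  have int: "integrable M (\<lambda>\<omega>. (norm (e \<omega>))\<^sup>2)"
    using e le_less_trans[OF nn ennreal_less_top] by (intro integrableI_nonneg) auto
  then show "square_integrable M e" using e by (simp add: square_integrable_def)
  show "(\<integral>\<omega>. (norm (e \<omega>))\<^sup>2 \<partial>M) \<le> \<sigma>\<^sup>2"
    using nn nn_integral_eq_integral[OF int] by simp
qed

section \<open>Integrability along the iteration\<close>

lemma square_integrable_gradient:
  fixes F :: "real ^ 'd \<Rightarrow> real"
  assumes M: "prob_space M"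
    and descent: "\<And>u v. F v \<le> F u + gradF u \<bullet> (v - u) + L / 2 * (norm (v - u))\<^sup>2"
    and lip: "\<And>x y. norm (gradF x - gradF y) \<le> L * norm (x - y)" and L: "L > 0"
    and low: "\<And>x. Mlow \<le> F x" and gradF: "gradF \<in> borel_measurable borel"
    and w: "w \<in> borel_measurable M" and z: "z \<in> borel_measurable M"
    and Fw: "integrable M (\<lambda>\<omega>. F (w \<omega>))" and zw: "square_integrable M (\<lambda>\<omega>. z \<omega> - w \<omega>)"
  shows "square_integrable M (\<lambda>\<omega>. gradF (w \<omega>))" "square_integrable M (\<lambda>\<omega>. gradF (z \<omega>))"
proof -
  interpret prob_space M by (rule M)
  note [measurable] = gradF w z
  show gw: "square_integrable M (\<lambda>\<omega>. gradF (w \<omega>))"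
  proof (rule square_integrable_bound)
    show "integrable M (\<lambda>\<omega>. 2 * L * (F (w \<omega>) - Mlow))" using Fw by simp
    show "AE \<omega> in M. (norm (gradF (w \<omega>)))\<^sup>2 \<le> 2 * L * (F (w \<omega>) - Mlow)"
      by (intro AE_I2 norm_gradient_le_suboptimality[where gradF = gradF] descent low L)
  qed measurable
  have "square_integrable M (\<lambda>\<omega>. gradF (z \<omega>) - gradF (w \<omega>))"
  proof (rule square_integrable_bound)
    show "integrable M (\<lambda>\<omega>. L\<^sup>2 * (norm (z \<omega> - w \<omega>))\<^sup>2)"
      using zw by (simp add: square_integrable_def)
    show "AE \<omega> in M. (norm (gradF (z \<omega>) - gradF (w \<omega>)))\<^sup>2 \<le> L\<^sup>2 * (norm (z \<omega> - w \<omega>))\<^sup>2"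
      unfolding power_mult_distrib[symmetric] by (intro AE_I2 power_mono lip) auto
  qed measurable
  from square_integrable_add[OF gw this] show "square_integrable M (\<lambda>\<omega>. gradF (z \<omega>))" by simp
qed

text \<open>
  The new value lies between \<open>Mlow\<close> and the integrable right-hand side of the descent inequality.
\<close>

lemma integrable_objective_after_step:
  fixes F :: "real ^ 'd \<Rightarrow> real"
  assumes M: "prob_space M"
    and descent: "\<And>u v. F v \<le> F u + gradF u \<bullet> (v - u) + L / 2 * (norm (v - u))\<^sup>2"
    and low: "\<And>x. Mlow \<le> F x" and F: "F \<in> borel_measurable borel"
    and Fw: "integrable M (\<lambda>\<omega>. F (w \<omega>))" and gw: "square_integrable M (\<lambda>\<omega>. gradF (w \<omega>))"
    and d: "square_integrable M d"
    and w': "w' \<in> borel_measurable M" "AE \<omega> in M. w' \<omega> = w \<omega> - d \<omega>"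
  shows "integrable M (\<lambda>\<omega>. F (w' \<omega>))"
proof -
  interpret prob_space M by (rule M)
  note [measurable] = F w'(1)
  let ?b = "\<lambda>\<omega>. \<bar>F (w \<omega>) - gradF (w \<omega>) \<bullet> d \<omega> + L / 2 * (norm (d \<omega>))\<^sup>2\<bar> + \<bar>Mlow\<bar>"
  show ?thesis
  proof (rule Bochner_Integration.integrable_bound)
    show "integrable M ?b"
      using Fw d integrable_inner_square_integrable[OF gw d] by (simp add: square_integrable_def)
    show "AE \<omega> in M. norm (F (w' \<omega>)) \<le> norm (?b \<omega>)"
      using w'(2)
    proof eventually_elim
      case (elim \<omega>)
      then show ?case
        using descent[of "w' \<omega>" "w \<omega>"] low[of "w' \<omega>"] by simp
    qed
  qed measurable
qed

text \<open>
  The induction carries integrability of \<open>F (w n)\<close> together with square integrability of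
  \<open>z n - w n\<close> and of the damped lag \<open>(1 - \<mu> n) *\<^sub>R (\<theta> n - w n)\<close>. The damping factor is essential
  at \<open>n = 1\<close>, where \<open>\<theta> 1 - w 1\<close> may fail to be square integrable: there it equals \<open>0\<close>, and \<open>z 1\<close>
  coincides with \<open>w 1\<close>.
\<close>

lemma iterates_square_integrable:
  fixes F :: "real ^ 'd \<Rightarrow> real" and w \<theta> z g \<gamma> l a :: "nat \<Rightarrow> 'a \<Rightarrow> real ^ 'd"
    and \<mu> :: "nat \<Rightarrow> real"
  assumes M: "prob_space M"
    and descent: "\<And>u v. F v \<le> F u + gradF u \<bullet> (v - u) + L / 2 * (norm (v - u))\<^sup>2"
    and lip: "\<And>x y. norm (gradF x - gradF y) \<le> L * norm (x - y)" and L: "L > 0"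
    and low: "\<And>x. Mlow \<le> F x"
    and F: "F \<in> borel_measurable borel" and gradF: "gradF \<in> borel_measurable borel"
    and meas: "\<And>n. 1 \<le> n \<Longrightarrow> w n \<in> borel_measurable M \<and> \<theta> n \<in> borel_measurable M \<and>
       z n \<in> borel_measurable M \<and> g n \<in> borel_measurable M \<and> \<gamma> n \<in> borel_measurable M \<and>
       l n \<in> borel_measurable M \<and> a n \<in> borel_measurable M"
    and Fw1: "integrable M (\<lambda>\<omega>. F (w 1 \<omega>))"
    and z: "\<And>n. 1 \<le> n \<Longrightarrow> AE \<omega> in M. z n \<omega> = (1 - \<gamma> n \<omega>) * \<theta> n \<omega> + \<gamma> n \<omega> * w n \<omega>"
    and w: "\<And>n. 1 \<le> n \<Longrightarrow> AE \<omega> in M. w (Suc n) \<omega> = w n \<omega> - l n \<omega> * g n \<omega>"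
    and \<theta>: "\<And>n. 1 \<le> n \<Longrightarrow>
       AE \<omega> in M. \<theta> (Suc n) \<omega> = (1 - \<mu> n) *\<^sub>R \<theta> n \<omega> + \<mu> n *\<^sub>R w n \<omega> - a n \<omega> * g n \<omega>"
    and \<mu>1: "\<mu> 1 = 1" and \<gamma>1: "AE \<omega> in M. \<gamma> 1 \<omega> = 1"
    and \<gamma>: "\<And>n. 2 \<le> n \<Longrightarrow> AE \<omega> in M. norm (1 - \<gamma> n \<omega>) \<le> K"
    and K: "\<And>n. 1 \<le> n \<Longrightarrow> AE \<omega> in M. norm (l n \<omega>) \<le> K'"
           "\<And>n. 1 \<le> n \<Longrightarrow> AE \<omega> in M. norm (a n \<omega>) \<le> K'"
    and noise: "\<And>n. 1 \<le> n \<Longrightarrow> square_integrable M (\<lambda>\<omega>. g n \<omega> - gradF (z n \<omega>))"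
    and n: "1 \<le> n"
  shows "square_integrable M (\<lambda>\<omega>. gradF (w n \<omega>))" "square_integrable M (\<lambda>\<omega>. gradF (z n \<omega>))"
proof -
  note grad = square_integrable_gradient[OF M descent lip L low gradF]
  have "integrable M (\<lambda>\<omega>. F (w n \<omega>)) \<and> square_integrable M (\<lambda>\<omega>. z n \<omega> - w n \<omega>)
    \<and> square_integrable M (\<lambda>\<omega>. (1 - \<mu> n) *\<^sub>R (\<theta> n \<omega> - w n \<omega>))"
    using n
  proof (induction n rule: nat_induct_at_least)
    case base
    have "square_integrable M (\<lambda>\<omega>. z 1 \<omega> - w 1 \<omega>)"
    proof (rule square_integrable_bound)
      show "(\<lambda>\<omega>. z 1 \<omega> - w 1 \<omega>) \<in> borel_measurable M" using meas[of 1] by (intro borel_measurable_diff) auto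
      show "AE \<omega> in M. (norm (z 1 \<omega> - w 1 \<omega>))\<^sup>2 \<le> (\<lambda>_. 0) \<omega>"
        using z[of 1, simplified] \<gamma>1 by eventually_elim simp
    qed simp
    then show ?case using Fw1 \<mu>1 by (simp add: square_integrable_def)
  next
    case (Suc n)
    have n: "1 \<le> n" "2 \<le> Suc n" "1 \<le> Suc n" using Suc by auto
    note mn = meas[OF n(1)] and mS = meas[OF n(3)]
    have gw: "square_integrable M (\<lambda>\<omega>. gradF (w n \<omega>))" and gz: "square_integrable M (\<lambda>\<omega>. gradF (z n \<omega>))"
      using grad[of "w n" "z n"] mn Suc by auto
    have g: "square_integrable M (g n)"
      using square_integrable_add[OF gz noise[OF n(1)]] by simp
    have lg: "square_integrable M (\<lambda>\<omega>. l n \<omega> * g n \<omega>)"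
      using mn by (intro square_integrable_hadamard_bounded[OF _ K(1)[OF n(1)] g]) auto
    have ag: "square_integrable M (\<lambda>\<omega>. a n \<omega> * g n \<omega>)"
      using mn by (intro square_integrable_hadamard_bounded[OF _ K(2)[OF n(1)] g]) auto
    have "integrable M (\<lambda>\<omega>. F (w (Suc n) \<omega>))"
      using Suc mS by (intro integrable_objective_after_step[OF M descent low F _ gw lg _ w[OF n(1)]]) auto
    moreover have D: "square_integrable M (\<lambda>\<omega>. \<theta> (Suc n) \<omega> - w (Suc n) \<omega>)"
    proof (rule square_integrable_bound)
      let ?X = "\<lambda>\<omega>. (1 - \<mu> n) *\<^sub>R (\<theta> n \<omega> - w n \<omega>) + (l n \<omega> * g n \<omega> - a n \<omega> * g n \<omega>)"
      show "integrable M (\<lambda>\<omega>. (norm (?X \<omega>))\<^sup>2)"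
        using square_integrable_add[OF _ square_integrable_diff[OF lg ag]] Suc(2)
        unfolding square_integrable_def by blast
      show "(\<lambda>\<omega>. \<theta> (Suc n) \<omega> - w (Suc n) \<omega>) \<in> borel_measurable M"
        using mS by (intro borel_measurable_diff) auto
      show "AE \<omega> in M. (norm (\<theta> (Suc n) \<omega> - w (Suc n) \<omega>))\<^sup>2 \<le> (norm (?X \<omega>))\<^sup>2"
        using w[OF n(1)] \<theta>[OF n(1)]
      proof eventually_elim
        case (elim \<omega>)
        have "\<theta> (Suc n) \<omega> - w (Suc n) \<omega> = ?X \<omega>"
          unfolding elim by (simp add: algebra_simps)
        then show ?case by simp
      qed
    qed
    moreover have "square_integrable M (\<lambda>\<omega>. z (Suc n) \<omega> - w (Suc n) \<omega>)"
    proof (rule square_integrable_bound)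
      let ?X = "\<lambda>\<omega>. (1 - \<gamma> (Suc n) \<omega>) * (\<theta> (Suc n) \<omega> - w (Suc n) \<omega>)"
      show "integrable M (\<lambda>\<omega>. (norm (?X \<omega>))\<^sup>2)"
        using square_integrable_hadamard_bounded[OF borel_measurable_diff[OF borel_measurable_const]
            \<gamma>[OF n(2)] D] mS
        by (simp add: square_integrable_def)
      show "(\<lambda>\<omega>. z (Suc n) \<omega> - w (Suc n) \<omega>) \<in> borel_measurable M"
        using mS by (intro borel_measurable_diff) auto
      show "AE \<omega> in M. (norm (z (Suc n) \<omega> - w (Suc n) \<omega>))\<^sup>2 \<le> (norm (?X \<omega>))\<^sup>2"
        using z[OF n(3)]
      proof eventually_elim
        case (elim \<omega>)
        have "z (Suc n) \<omega> - w (Suc n) \<omega> = ?X \<omega>"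
          unfolding elim by (simp add: algebra_simps)
        then show ?case by simp
      qed
    qed
    ultimately show ?case using square_integrable_scaleR[OF D] by simp
  qed
  then show "square_integrable M (\<lambda>\<omega>. gradF (w n \<omega>))" "square_integrable M (\<lambda>\<omega>. gradF (z n \<omega>))"
    using grad[of "w n" "z n"] meas[OF n] by auto
qed

section \<open>Convergence of the averaged adaptive scheme\<close>

theorem theorem6:
  fixes M :: "'a measure"
    and F :: "real ^ 'd \<Rightarrow> real"
    and gradF :: "real ^ 'd \<Rightarrow> real ^ 'd"
    and L Mlow B \<sigma> :: real
    and \<theta> w z y g \<gamma> lam \<alpha> :: "nat \<Rightarrow> 'a \<Rightarrow> real ^ 'd"
    and \<mu> :: "nat \<Rightarrow> real"
    and \<F> :: "nat \<Rightarrow> 'a measure"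
  assumes "prob_space M"
    \<comment> \<open>the objective\<close>
    and "\<forall>x. GDERIV F x :> gradF x"
    and "continuous_on UNIV gradF"
    and "\<forall>x. Mlow \<le> F x"
    and "L > 0"
    and "\<forall>x y. norm (gradF x - gradF y) \<le> L * norm (x - y)"
    \<comment> \<open>the random vectors and the recursion\<close>
    and "\<forall>n\<ge>1. \<theta> n \<in> borel_measurable M \<and> w n \<in> borel_measurable M \<and>
                z n \<in> borel_measurable M \<and> y n \<in> borel_measurable M \<and>
                g n \<in> borel_measurable M \<and> \<gamma> n \<in> borel_measurable M \<and>
                lam n \<in> borel_measurable M \<and> \<alpha> n \<in> borel_measurable M"
    and "integrable M (\<lambda>\<omega>. F (w 1 \<omega>))"
    and "\<forall>n\<ge>1. AE \<omega> in M. z n \<omega> = (1 - \<gamma> n \<omega>) * \<theta> n \<omega> + \<gamma> n \<omega> * w n \<omega>"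
    and "\<forall>n\<ge>1. AE \<omega> in M. y n \<omega> = (1 - \<mu> n) *\<^sub>R \<theta> n \<omega> + \<mu> n *\<^sub>R w n \<omega>"
    and "\<forall>n\<ge>1. AE \<omega> in M. w (Suc n) \<omega> = w n \<omega> - lam n \<omega> * g n \<omega>"
    and "\<forall>n\<ge>1. AE \<omega> in M. \<theta> (Suc n) \<omega> = y n \<omega> - \<alpha> n \<omega> * g n \<omega>"
    \<comment> \<open>the parameters\<close>
    and "\<mu> 1 = 1"
    and "\<forall>n\<ge>2. 0 < \<mu> n \<and> \<mu> n < 1"
    and "AE \<omega> in M. \<gamma> 1 \<omega> = 1"
    and "\<forall>n\<ge>1. AE \<omega> in M. \<forall>i. 0 < \<gamma> n \<omega> $ i"
    and "AE \<omega> in M. bounded ((\<lambda>n. \<gamma> n \<omega>) ` {1..})"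
    and "\<forall>n\<ge>1. AE \<omega> in M. \<forall>i. 0 < lam n \<omega> $ i \<and> 0 < \<alpha> n \<omega> $ i"
    and "\<exists>K. \<forall>n\<ge>1. AE \<omega> in M. norm (lam n \<omega>) \<le> K \<and> norm (\<alpha> n \<omega>) \<le> K"
    and "\<forall>n\<ge>2. AE \<omega> in M. (norm (1 - \<gamma> n \<omega>))\<^sup>2 / (1 - \<mu> n) \<le> B"
    \<comment> \<open>the filtration and the noise\<close>
    and "\<forall>n\<ge>1. subalgebra M (\<F> n)"
    and "\<forall>n\<ge>1. sets (\<F> n) \<subseteq> sets (\<F> (Suc n))"
    and "\<forall>n\<ge>1. w n \<in> borel_measurable (\<F> n) \<and> z n \<in> borel_measurable (\<F> n) \<and>
                lam n \<in> borel_measurable (\<F> n) \<and> \<alpha> n \<in> borel_measurable (\<F> n)"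
    and "\<forall>n\<ge>1. AE \<omega> in M. vec_cond_exp M (\<F> n) (g n) \<omega> = gradF (z n \<omega>)"
    and "\<sigma> > 0"
    and "\<forall>n\<ge>1. AE \<omega> in M.
           nn_cond_exp M (\<F> n) (\<lambda>\<omega>'. ennreal ((norm (g n \<omega>' - gradF (z n \<omega>')))\<^sup>2)) \<omega>
             \<le> ennreal (\<sigma>\<^sup>2)"
    and "bounded (Gam \<mu> ` {1..})"
  shows
    \<comment> \<open>part (i)\<close>
    "(\<forall>N\<ge>1. \<forall>(m :: nat \<Rightarrow> real) (R :: nat \<Rightarrow> real).
        (\<exists>K>0. \<forall>n\<in>{1..N}. Csum \<mu> n N \<le> K) \<longrightarrow>
        (\<forall>n\<in>{1..N}. m n > 0 \<and> R n > 0) \<longrightarrow>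
        (\<forall>n\<in>{1..N}. AE \<omega> in M. \<forall>i.
           (lam n \<omega> - L *\<^sub>R (lam n \<omega>)\<^sup>2
              - (L * B / 2 * (Csum \<mu> n N / (\<mu> n * Gam \<mu> n))) *\<^sub>R (lam n \<omega> - \<alpha> n \<omega>)\<^sup>2) $ i
             \<ge> m n) \<longrightarrow>
        (\<forall>n\<in>{1..N}. AE \<omega> in M.
           (norm (lam n \<omega>))\<^sup>2
             + B * (Csum \<mu> n N / (\<mu> n * Gam \<mu> n)) * (norm (lam n \<omega> - \<alpha> n \<omega>))\<^sup>2 \<le> R n) \<longrightarrow>
        integrable M (\<lambda>\<omega>. Min ((\<lambda>n. (norm (gradF (z n \<omega>)))\<^sup>2) ` {1..N})) \<and>
        (\<integral>\<omega>. Min ((\<lambda>n. (norm (gradF (z n \<omega>)))\<^sup>2) ` {1..N}) \<partial>M)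
          \<le> (((\<integral>\<omega>. F (w 1 \<omega>) \<partial>M) - Mlow) + L / 2 * \<sigma>\<^sup>2 * (\<Sum>n=1..N. R n))
             / (\<Sum>n=1..N. m n))
     \<and>
     \<comment> \<open>part (ii)\<close>
     (\<forall>(m :: nat \<Rightarrow> real) (R :: nat \<Rightarrow> nat \<Rightarrow> real).
        (\<forall>N\<ge>1. \<exists>K>0. \<forall>n\<in>{1..N}. Csum \<mu> n N \<le> K) \<longrightarrow>
        (\<forall>N\<ge>1. \<forall>n\<in>{1..N}. m n > 0 \<and> R n N > 0) \<longrightarrow>
        (\<forall>N\<ge>1. \<forall>n\<in>{1..N}. AE \<omega> in M. \<forall>i.
           (lam n \<omega> - L *\<^sub>R (lam n \<omega>)\<^sup>2
              - (L * B / 2 * (Csum \<mu> n N / (\<mu> n * Gam \<mu> n))) *\<^sub>R (lam n \<omega> - \<alpha> n \<omega>)\<^sup>2) $ i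
             \<ge> m n) \<longrightarrow>
        (\<forall>N\<ge>1. \<forall>n\<in>{1..N}. AE \<omega> in M.
           (norm (lam n \<omega>))\<^sup>2
             + B * (Csum \<mu> n N / (\<mu> n * Gam \<mu> n)) * (norm (lam n \<omega> - \<alpha> n \<omega>))\<^sup>2 \<le> R n N) \<longrightarrow>
        convergent (\<lambda>N. \<Sum>n=1..N. R n N) \<longrightarrow>
        (\<forall>n\<ge>1. integrable M (\<lambda>\<omega>. (norm (gradF (z n \<omega>)))\<^sup>2)) \<and>
        summable (\<lambda>n. m (Suc n) * (\<integral>\<omega>. (norm (gradF (z (Suc n) \<omega>)))\<^sup>2 \<partial>M)) \<and>
        (\<Sum>n. m (Suc n) * (\<integral>\<omega>. (norm (gradF (z (Suc n) \<omega>)))\<^sup>2 \<partial>M))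
          \<le> ((\<integral>\<omega>. F (w 1 \<omega>) \<partial>M) - Mlow)
             + L / 2 * \<sigma>\<^sup>2 * lim (\<lambda>N. \<Sum>n=1..N. R n N))"
proof -
  interpret prob_space M by (rule assms(1))
  have grad: "\<And>x. GDERIV F x :> gradF x" and low: "\<And>x. Mlow \<le> F x" and L: "L > 0"
    and lip: "\<And>x y. norm (gradF x - gradF y) \<le> L * norm (x - y)"
    and \<mu>1: "\<mu> 1 = 1" and \<mu>: "\<And>n. 2 \<le> n \<Longrightarrow> 0 < \<mu> n \<and> \<mu> n < 1"
    using assms(2,4,5,6,13,14) by auto
  note descent = descent_lemma[of F gradF L, OF grad lip]
  have "continuous_on UNIV F"
    using assms(2) unfolding gderiv_def
    by (auto intro!: continuous_at_imp_continuous_on has_derivative_continuous)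
  then have F_meas: "F \<in> borel_measurable borel" by (rule borel_measurable_continuous_onI)
  have gradF_meas: "gradF \<in> borel_measurable borel"
    using assms(3) by (rule borel_measurable_continuous_onI)
  have meas: "\<theta> n \<in> borel_measurable M" "w n \<in> borel_measurable M" "z n \<in> borel_measurable M"
     "g n \<in> borel_measurable M" "\<gamma> n \<in> borel_measurable M" "lam n \<in> borel_measurable M"
     "\<alpha> n \<in> borel_measurable M" if "1 \<le> n" for n
    using assms(7) that by auto
  have z: "AE \<omega> in M. z n \<omega> = (1 - \<gamma> n \<omega>) * \<theta> n \<omega> + \<gamma> n \<omega> * w n \<omega>" if "1 \<le> n" for n
    using assms(9) that by auto
  have w: "AE \<omega> in M. w (Suc n) \<omega> = w n \<omega> - lam n \<omega> * g n \<omega>" if "1 \<le> n" for n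
    using assms(11) that by auto
  have \<theta>: "AE \<omega> in M. \<theta> (Suc n) \<omega> = (1 - \<mu> n) *\<^sub>R \<theta> n \<omega> + \<mu> n *\<^sub>R w n \<omega> - \<alpha> n \<omega> * g n \<omega>"
    if "1 \<le> n" for n
    using assms(10)[rule_format, OF that] assms(12)[rule_format, OF that] by eventually_elim simp
  note \<gamma>1 = assms(15)
  have \<gamma>B: "AE \<omega> in M. (norm (1 - \<gamma> n \<omega>))\<^sup>2 / (1 - \<mu> n) \<le> B" if "2 \<le> n" for n
    using assms(20) that by auto
  \<comment> \<open>an almost sure inequality between nonrandom numbers holds, by nontriviality of a probability measure\<close>
  have B: "0 \<le> B"
  proof -
    have "AE \<omega> in M. 0 \<le> B"
      using \<gamma>B[of 2, simplified]
    proof eventually_elim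
      case (elim \<omega>)
      have "0 \<le> (norm (1 - \<gamma> 2 \<omega>))\<^sup>2 / (1 - \<mu> 2)" using \<mu>[of 2] by simp
      then show ?case using elim by linarith
    qed
    then show ?thesis by simp
  qed
  have \<gamma>: "AE \<omega> in M. norm (1 - \<gamma> n \<omega>) \<le> sqrt B" if n: "2 \<le> n" for n
    using \<gamma>B[OF n]
  proof eventually_elim
    case (elim \<omega>)
    then have "(norm (1 - \<gamma> n \<omega>))\<^sup>2 \<le> B * (1 - \<mu> n)"
      using \<mu>[OF n] by (simp add: divide_le_eq)
    also have "\<dots> \<le> B"
      using B \<mu>[OF n] by (simp add: mult_left_le)
    finally show ?case by (rule real_le_rsqrt)
  qed
  obtain K where K: "\<And>n. 1 \<le> n \<Longrightarrow> AE \<omega> in M. norm (lam n \<omega>) \<le> K \<and> norm (\<alpha> n \<omega>) \<le> K"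
    using assms(19) by auto
  have Kl: "AE \<omega> in M. norm (lam n \<omega>) \<le> K" and Ka: "AE \<omega> in M. norm (\<alpha> n \<omega>) \<le> K"
    if "1 \<le> n" for n
    using K[OF that] by (auto elim: eventually_mono)
  have sub: "subalgebra M (\<F> n)" if "1 \<le> n" for n using assms(21) that by auto
  have adapted: "w n \<in> borel_measurable (\<F> n)" "z n \<in> borel_measurable (\<F> n)"
     "lam n \<in> borel_measurable (\<F> n)" "\<alpha> n \<in> borel_measurable (\<F> n)" if "1 \<le> n" for n
    using assms(23) that by auto
  define s where "s = (\<lambda>n \<omega>. gradF (z n \<omega>))"
  define e where "e = (\<lambda>n \<omega>. g n \<omega> - s n \<omega>)"
  have s_meas: "s n \<in> borel_measurable M" if "1 \<le> n" for n
    unfolding s_def by (rule measurable_compose[OF meas(3)[OF that] gradF_meas])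
  have e_meas: "e n \<in> borel_measurable M" if "1 \<le> n" for n
    unfolding e_def by (intro borel_measurable_diff meas s_meas that)
  have noise: "square_integrable M (e n)" "expectation (\<lambda>\<omega>. (norm (e n \<omega>))\<^sup>2) \<le> \<sigma>\<^sup>2"
    if n: "1 \<le> n" for n
  proof -
    have le: "AE \<omega> in M. nn_cond_exp M (\<F> n) (\<lambda>\<omega>'. ennreal ((norm (e n \<omega>'))\<^sup>2)) \<omega> \<le> ennreal (\<sigma>\<^sup>2)"
      using assms(26) n unfolding e_def s_def by auto
    note sm = square_integrable_of_cond_second_moment[OF assms(1) sub[OF n] e_meas[OF n] le]
    show "square_integrable M (e n)" "expectation (\<lambda>\<omega>. (norm (e n \<omega>))\<^sup>2) \<le> \<sigma>\<^sup>2"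
      by (fact sm)+
  qed
  have sq: "square_integrable M (\<lambda>\<omega>. gradF (w n \<omega>))" "square_integrable M (s n)" if n: "1 \<le> n" for n
  proof -
    note it = iterates_square_integrable[of M F gradF L Mlow w \<theta> z g \<gamma> lam \<alpha> \<mu> "sqrt B" K n,
        OF assms(1) descent lip L low F_meas gradF_meas _ assms(8) z w \<theta> \<mu>1 \<gamma>1 \<gamma> Kl Ka]
    have n1: "square_integrable M (\<lambda>\<omega>. g k \<omega> - gradF (z k \<omega>))" if "1 \<le> k" for k
      using noise(1)[OF that] unfolding e_def s_def .
    show "square_integrable M (\<lambda>\<omega>. gradF (w n \<omega>))"
      by (rule it(1)) (use meas n1 n in auto)
    show "square_integrable M (s n)"
      unfolding s_def by (rule it(2)) (use meas n1 n in auto)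
  qed
  have s_int: "integrable M (\<lambda>\<omega>. (norm (s n \<omega>))\<^sup>2)" if "1 \<le> n" for n
    using sq(2)[OF that] by (simp add: square_integrable_def)
  have e_int: "integrable M (\<lambda>\<omega>. (norm (e n \<omega>))\<^sup>2)" if "1 \<le> n" for n
    using noise(1)[OF that] by (simp add: square_integrable_def)

  \<comment> \<open>The stepsizes are bounded, so the coefficient is square integrable, and it is measurable with
    respect to \<open>\<F> n\<close>; hence it is uncorrelated with the noise.\<close>
  have martingale: "integrable M (\<lambda>\<omega>. noise_coeff gradF L \<kappa> (lam n \<omega>) (\<alpha> n \<omega>) (w n \<omega>) (z n \<omega>) \<bullet> e n \<omega>)"
      "expectation (\<lambda>\<omega>. noise_coeff gradF L \<kappa> (lam n \<omega>) (\<alpha> n \<omega>) (w n \<omega>) (z n \<omega>) \<bullet> e n \<omega>) = 0"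
    if n: "1 \<le> n" for n \<kappa>
  proof -
    let ?h = "\<lambda>\<omega>. noise_coeff gradF L \<kappa> (lam n \<omega>) (\<alpha> n \<omega>) (w n \<omega>) (z n \<omega>)"
    have hF: "?h \<in> borel_measurable (\<F> n)"
      unfolding noise_coeff_def
      by (intro borel_measurable_add borel_measurable_diff borel_measurable_scaleR borel_measurable_const
          borel_measurable_hadamard adapted n measurable_compose[OF adapted(1)[OF n] gradF_meas]
          measurable_compose[OF adapted(2)[OF n] gradF_meas])
    have d: "AE \<omega> in M. norm (lam n \<omega> - \<alpha> n \<omega>) \<le> K + K"
      using Kl[OF n] Ka[OF n]
    proof eventually_elim
      case (elim \<omega>)
      then show ?case using norm_triangle_ineq4[of "lam n \<omega>" "\<alpha> n \<omega>"] by linarith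
    qed
    have h: "square_integrable M ?h"
      unfolding noise_coeff_def
      by (intro square_integrable_add square_integrable_diff square_integrable_scaleR
          square_integrable_hadamard_bounded[OF _ Kl[OF n]] square_integrable_hadamard_bounded[OF _ d]
          borel_measurable_diff meas n sq(1) sq(2)[unfolded s_def])
    have g: "square_integrable M (g n)"
      using square_integrable_add[OF sq(2)[OF n] noise(1)[OF n]] by (simp add: e_def)
    show "integrable M (\<lambda>\<omega>. ?h \<omega> \<bullet> e n \<omega>)"
      by (rule integrable_inner_square_integrable[OF h noise(1)[OF n]])
    show "expectation (\<lambda>\<omega>. ?h \<omega> \<bullet> e n \<omega>) = 0"
      unfolding e_def
      by (rule expectation_inner_cond_exp_residual[OF assms(1) sub[OF n] hF h g sq(2)[OF n]])
        (use assms(24) n in \<open>auto simp: s_def\<close>)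
  qed

  \<comment> \<open>the expected energy inequality, from which both parts are read off\<close>
  have energy: "(\<Sum>n=1..N. m n * expectation (\<lambda>\<omega>. (norm (s n \<omega>))\<^sup>2))
      \<le> (expectation (\<lambda>\<omega>. F (w 1 \<omega>)) - Mlow) + L / 2 * \<sigma>\<^sup>2 * (\<Sum>n=1..N. R n)"
    if R0: "\<forall>n\<in>{1..N}. m n > 0 \<and> R n > 0"
      and m: "\<forall>n\<in>{1..N}. AE \<omega> in M. \<forall>i.
           (lam n \<omega> - L *\<^sub>R (lam n \<omega>)\<^sup>2
              - (L * B / 2 * (Csum \<mu> n N / (\<mu> n * Gam \<mu> n))) *\<^sub>R (lam n \<omega> - \<alpha> n \<omega>)\<^sup>2) $ i
             \<ge> m n"
      and R: "\<forall>n\<in>{1..N}. AE \<omega> in M.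
           (norm (lam n \<omega>))\<^sup>2
             + B * (Csum \<mu> n N / (\<mu> n * Gam \<mu> n)) * (norm (lam n \<omega> - \<alpha> n \<omega>))\<^sup>2 \<le> R n"
    for N and m R :: "nat \<Rightarrow> real"
  proof -
    define h where "h = (\<lambda>n \<omega>. noise_coeff gradF L (B * (Csum \<mu> n N / (\<mu> n * Gam \<mu> n)))
      (lam n \<omega>) (\<alpha> n \<omega>) (w n \<omega>) (z n \<omega>))"
    have zN: "AE \<omega> in M. \<forall>n\<in>{1..N}. z n \<omega> = (1 - \<gamma> n \<omega>) * \<theta> n \<omega> + \<gamma> n \<omega> * w n \<omega>"
      and wN: "AE \<omega> in M. \<forall>n\<in>{1..N}. w (Suc n) \<omega> = w n \<omega> - lam n \<omega> * g n \<omega>"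
      and \<theta>N: "AE \<omega> in M. \<forall>n\<in>{1..N}.
        \<theta> (Suc n) \<omega> = (1 - \<mu> n) *\<^sub>R \<theta> n \<omega> + \<mu> n *\<^sub>R w n \<omega> - \<alpha> n \<omega> * g n \<omega>"
      and \<gamma>N: "AE \<omega> in M. \<forall>n\<in>{2..N}. (norm (1 - \<gamma> n \<omega>))\<^sup>2 / (1 - \<mu> n) \<le> B"
      by (rule AE_finite_allI; use z w \<theta> \<gamma>B in simp)+
    have mN: "AE \<omega> in M. \<forall>n\<in>{1..N}. \<forall>i.
           (lam n \<omega> - L *\<^sub>R (lam n \<omega>)\<^sup>2
              - (L * B / 2 * (Csum \<mu> n N / (\<mu> n * Gam \<mu> n))) *\<^sub>R (lam n \<omega> - \<alpha> n \<omega>)\<^sup>2) $ i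
             \<ge> m n"
      by (rule AE_finite_allI) (use m in blast)+
    have RN: "AE \<omega> in M. \<forall>n\<in>{1..N}.
           (norm (lam n \<omega>))\<^sup>2
             + B * (Csum \<mu> n N / (\<mu> n * Gam \<mu> n)) * (norm (lam n \<omega> - \<alpha> n \<omega>))\<^sup>2 \<le> R n"
      by (rule AE_finite_allI) (use R in blast)+
    have path: "AE \<omega> in M. (\<Sum>n=1..N. m n * (norm (s n \<omega>))\<^sup>2)
      \<le> F (w 1 \<omega>) - Mlow + (\<Sum>n=1..N. L / 2 * R n * (norm (e n \<omega>))\<^sup>2) + (\<Sum>n=1..N. h n \<omega> \<bullet> e n \<omega>)"
      using zN wN \<theta>N \<gamma>N \<gamma>1 mN RN
    proof eventually_elim
      case (elim \<omega>)
      show ?case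
        unfolding s_def e_def h_def
        by (rule pathwise_energy_bound[where F = F and gradF = gradF and L = L and \<mu> = \<mu> and N = N
              and w = "\<lambda>n. w n \<omega>" and \<theta> = "\<lambda>n. \<theta> n \<omega>" and z = "\<lambda>n. z n \<omega>"
              and g = "\<lambda>n. g n \<omega>" and \<gamma> = "\<lambda>n. \<gamma> n \<omega>" and l = "\<lambda>n. lam n \<omega>"
              and a = "\<lambda>n. \<alpha> n \<omega>", OF descent lip L low B \<mu>1 \<mu>])
          (use elim in auto)
    qed
    have s_sum: "integrable M (\<lambda>\<omega>. \<Sum>n=1..N. m n * (norm (s n \<omega>))\<^sup>2)"
      by (intro Bochner_Integration.integrable_sum integrable_mult_right s_int) simp
    have e_sum: "integrable M (\<lambda>\<omega>. \<Sum>n=1..N. L / 2 * R n * (norm (e n \<omega>))\<^sup>2)"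
      by (intro Bochner_Integration.integrable_sum integrable_mult_right e_int) simp
    have h_sum: "integrable M (\<lambda>\<omega>. \<Sum>n=1..N. h n \<omega> \<bullet> e n \<omega>)"
      unfolding h_def by (intro Bochner_Integration.integrable_sum martingale) simp
    have h0: "expectation (\<lambda>\<omega>. \<Sum>n=1..N. h n \<omega> \<bullet> e n \<omega>) = 0"
      unfolding h_def
      by (subst Bochner_Integration.integral_sum) (auto intro!: martingale sum.neutral)
    have "(\<Sum>n=1..N. m n * expectation (\<lambda>\<omega>. (norm (s n \<omega>))\<^sup>2))
        = expectation (\<lambda>\<omega>. \<Sum>n=1..N. m n * (norm (s n \<omega>))\<^sup>2)"
      by (subst Bochner_Integration.integral_sum) (auto intro!: s_int)
    also have "\<dots> \<le> expectation (\<lambda>\<omega>. F (w 1 \<omega>) - Mlow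
        + (\<Sum>n=1..N. L / 2 * R n * (norm (e n \<omega>))\<^sup>2) + (\<Sum>n=1..N. h n \<omega> \<bullet> e n \<omega>))"
      using assms(8) e_sum h_sum by (intro integral_mono_AE s_sum path) auto
    also have "\<dots> = expectation (\<lambda>\<omega>. F (w 1 \<omega>)) - Mlow
        + expectation (\<lambda>\<omega>. \<Sum>n=1..N. L / 2 * R n * (norm (e n \<omega>))\<^sup>2)"
      using assms(8) e_sum h_sum h0 by (simp add: prob_space)
    also have "expectation (\<lambda>\<omega>. \<Sum>n=1..N. L / 2 * R n * (norm (e n \<omega>))\<^sup>2)
        = (\<Sum>n=1..N. L / 2 * R n * expectation (\<lambda>\<omega>. (norm (e n \<omega>))\<^sup>2))"
      by (subst Bochner_Integration.integral_sum)
        (intro integrable_mult_right e_int, simp, simp only: integral_mult_right_zero)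
    also have "\<dots> \<le> (\<Sum>n=1..N. L / 2 * R n * \<sigma>\<^sup>2)"
    proof (intro sum_mono mult_left_mono)
      fix n assume n: "n \<in> {1..N}"
      then show "expectation (\<lambda>\<omega>. (norm (e n \<omega>))\<^sup>2) \<le> \<sigma>\<^sup>2" by (intro noise) simp
      show "0 \<le> L / 2 * R n" using L R0 n by (simp add: less_imp_le)
    qed
    also have "\<dots> = L / 2 * \<sigma>\<^sup>2 * (\<Sum>n=1..N. R n)"
      by (simp add: sum_distrib_left algebra_simps)
    finally show ?thesis by simp
  qed

  have s_eq: "gradF (z n \<omega>) = s n \<omega>" for n \<omega> by (simp add: s_def)
  show ?thesis
    unfolding s_eq
  proof (intro conjI allI impI)
    fix N :: nat and m R :: "nat \<Rightarrow> real"
    assume N: "1 \<le> N" and R0: "\<forall>n\<in>{1..N}. m n > 0 \<and> R n > 0"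
      and m: "\<forall>n\<in>{1..N}. AE \<omega> in M. \<forall>i.
           (lam n \<omega> - L *\<^sub>R (lam n \<omega>)\<^sup>2
              - (L * B / 2 * (Csum \<mu> n N / (\<mu> n * Gam \<mu> n))) *\<^sub>R (lam n \<omega> - \<alpha> n \<omega>)\<^sup>2) $ i
             \<ge> m n"
      and R: "\<forall>n\<in>{1..N}. AE \<omega> in M.
           (norm (lam n \<omega>))\<^sup>2
             + B * (Csum \<mu> n N / (\<mu> n * Gam \<mu> n)) * (norm (lam n \<omega> - \<alpha> n \<omega>))\<^sup>2 \<le> R n"
    let ?min = "\<lambda>\<omega>. Min ((\<lambda>n. (norm (s n \<omega>))\<^sup>2) ` {1..N})"
    show min_int: "integrable M ?min"
    proof (rule Bochner_Integration.integrable_bound[OF s_int[of 1]])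
      show "?min \<in> borel_measurable M"
        by (intro borel_measurable_Min borel_measurable_integrable s_int) auto
      show "AE \<omega> in M. norm (?min \<omega>) \<le> norm ((norm (s 1 \<omega>))\<^sup>2)"
      proof (rule AE_I2)
        fix \<omega>
        have "0 \<le> ?min \<omega>" using N by (subst Min_ge_iff) auto
        moreover have "?min \<omega> \<le> (norm (s 1 \<omega>))\<^sup>2" using N by (intro Min_le) auto
        ultimately show "norm (?min \<omega>) \<le> norm ((norm (s 1 \<omega>))\<^sup>2)" by simp
      qed
    qed simp
    have "(\<Sum>n=1..N. m n) * expectation ?min = (\<Sum>n=1..N. m n * expectation ?min)"
      by (simp add: sum_distrib_right)
    also have "\<dots> \<le> (\<Sum>n=1..N. m n * expectation (\<lambda>\<omega>. (norm (s n \<omega>))\<^sup>2))"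
      using R0 by (intro sum_mono mult_left_mono integral_mono min_int s_int) (auto simp: less_imp_le)
    also have "\<dots> \<le> (expectation (\<lambda>\<omega>. F (w 1 \<omega>)) - Mlow) + L / 2 * \<sigma>\<^sup>2 * (\<Sum>n=1..N. R n)"
      by (rule energy[OF R0 m R])
    finally show "expectation ?min
        \<le> (expectation (\<lambda>\<omega>. F (w 1 \<omega>)) - Mlow + L / 2 * \<sigma>\<^sup>2 * (\<Sum>n=1..N. R n)) / (\<Sum>n=1..N. m n)"
      using sum_pos[of "{1..N}" m] N R0 by (simp add: pos_le_divide_eq mult.commute)
  next
    fix m :: "nat \<Rightarrow> real" and R :: "nat \<Rightarrow> nat \<Rightarrow> real"
    assume R0: "\<forall>N\<ge>1. \<forall>n\<in>{1..N}. m n > 0 \<and> R n N > 0"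
      and m: "\<forall>N\<ge>1. \<forall>n\<in>{1..N}. AE \<omega> in M. \<forall>i.
           (lam n \<omega> - L *\<^sub>R (lam n \<omega>)\<^sup>2
              - (L * B / 2 * (Csum \<mu> n N / (\<mu> n * Gam \<mu> n))) *\<^sub>R (lam n \<omega> - \<alpha> n \<omega>)\<^sup>2) $ i
             \<ge> m n"
      and R: "\<forall>N\<ge>1. \<forall>n\<in>{1..N}. AE \<omega> in M.
           (norm (lam n \<omega>))\<^sup>2
             + B * (Csum \<mu> n N / (\<mu> n * Gam \<mu> n)) * (norm (lam n \<omega> - \<alpha> n \<omega>))\<^sup>2 \<le> R n N"
      and conv: "convergent (\<lambda>N. \<Sum>n=1..N. R n N)"
    show "integrable M (\<lambda>\<omega>. (norm (s n \<omega>))\<^sup>2)" if "1 \<le> n" for n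
      by (rule s_int[OF that])
    let ?f = "\<lambda>n. m (Suc n) * expectation (\<lambda>\<omega>. (norm (s (Suc n) \<omega>))\<^sup>2)"
    let ?b = "\<lambda>N. (expectation (\<lambda>\<omega>. F (w 1 \<omega>)) - Mlow) + L / 2 * \<sigma>\<^sup>2 * (\<Sum>n=1..N. R n N)"
    let ?l = "(expectation (\<lambda>\<omega>. F (w 1 \<omega>)) - Mlow) + L / 2 * \<sigma>\<^sup>2 * lim (\<lambda>N. \<Sum>n=1..N. R n N)"
    have b: "?b \<longlonglongrightarrow> ?l"
      using conv by (intro tendsto_intros) (simp add: convergent_LIMSEQ_iff)
    have f0: "0 \<le> ?f n" for n
    proof -
      have "0 < m (Suc n)" using R0[rule_format, of "Suc n" "Suc n"] by simp
      then show ?thesis by simp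
    qed
    have le: "(\<Sum>n<N. ?f n) \<le> ?b N" if N: "1 \<le> N" for N
    proof -
      have "(\<Sum>n<N. ?f n) = (\<Sum>n=1..N. m n * expectation (\<lambda>\<omega>. (norm (s n \<omega>))\<^sup>2))"
        by (simp add: sum.atLeast1_atMost_eq)
      also have "\<dots> \<le> ?b N"
        using R0 m R N by (intro energy) auto
      finally show ?thesis .
    qed
    \<comment> \<open>Fix the first \<open>k\<close> terms. The weights \<open>m\<close> are the same for all horizons \<open>N\<close>, so the
      inequality for \<open>N \<ge> k\<close> bounds these terms, and \<open>N\<close> may tend to infinity.\<close>
    have part: "(\<Sum>n<k. ?f n) \<le> ?l" for k
    proof (rule tendsto_lowerbound[OF b])
      show "\<forall>\<^sub>F N in sequentially. (\<Sum>n<k. ?f n) \<le> ?b N"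
        unfolding eventually_sequentially
      proof (intro exI allI impI)
        fix N assume N: "Suc k \<le> N"
        have "(\<Sum>n<k. ?f n) \<le> (\<Sum>n<N. ?f n)"
          using N f0 by (intro sum_mono2) auto
        also have "\<dots> \<le> ?b N" using N by (intro le) simp
        finally show "(\<Sum>n<k. ?f n) \<le> ?b N" .
      qed
    qed simp
    show f: "summable ?f"
      by (rule summableI_nonneg_bounded[OF f0 part])
    show "suminf ?f \<le> ?l"
      by (rule suminf_le_const[OF f part])
  qed
qed

end
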